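(* Let $q(t)=(x(t),\ell(t),y(t))$ be an arc-length parameterized sub-Riemannian geodesic of the $(4,7)$ control problem on $N=\mathbb{R}\oplus\mathbb{R}^3\oplus\mathbb{R}^3$ with $x(0)=0$, $\ell(0)=0$, $y(0)=0$, whose vertical constants satisfy $(K_1,K_2,K_3)\neq(0,0,0)$. View $q$ as the curve $x(t)+\ell(t)+y(t)$ in $\wedge^1\mathbb{R}^4\oplus\wedge^2\mathbb{R}^4\subset\mathbb{G}_4$. Then there exist $R\in SO(3)$ and real constants $K>0$, $C_1,C_2,C$ with $K^2(C_1^2+C_2^2)+C^2=1$ such that, up to the action of $R$, namely $(x,\ell,y)\mapsto(x,R\ell,Ry)$, the curve takes the form $$\begin{aligned} q(t)=&\ x(t)+\ell(t)+y(t)=\big(C_1\cos(Kt)+C_2\sin(Kt)-C_1\big)e_1\\ &+\big(C_1\sin(Kt)-C_2\cos(Kt)+C_2\big)e_2+Ct\,e_3\\ &+\tfrac12(C_1^2+C_2^2)\big(Kt-\sin(Kt)\big)\,e_1\wedge e_2\\ &+\tfrac{C}{2K}\big((2C_1-C_2Kt)\sin(Kt)-(C_1Kt+2C_2)\cos(Kt)+2C_2-C_1Kt\big)\,e_1\wedge e_3 . \end{aligned}$$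
   Context: The $(4,7)$ control problem: on $N=\mathbb{R}^7$ with coordinates $(x,\ell,y)=(x,\ell_1,\ell_2,\ell_3,y_1,y_2,y_3)$, the vector fields $Y_0=\partial_x-\frac{\ell_1}{2}\partial_{y_1}-\frac{\ell_2}{2}\partial_{y_2}-\frac{\ell_3}{2}\partial_{y_3}$ and $Y_i=\partial_{\ell_i}+\frac{x}{2}\partial_{y_i}$, $i=1,2,3$, are declared orthonormal, and one minimizes $\frac12\int(u_0^2+u_1^2+u_2^2+u_3^2)\,dt$ subject to $\dot q=u_0Y_0+u_1Y_1+u_2Y_2+u_3Y_3$. Geodesics are the projections to $N$ of the normal Pontryagin extremals of $H=\frac12(h_0^2+h_1^2+h_2^2+h_3^2)$. Explicitly, a geodesic is a curve $(x(t),\ell(t),y(t))$ for which there are real constants $K_1,K_2,K_3$ (the vertical constants) and a function $h=(h_0,\bar h)$ with $h_0(t)\in\mathbb{R}$, $\bar h(t)=(h_1,h_2,h_3)^T\in\mathbb{R}^3$ such that $$\dot h=-\Omega h,\quad \Omega=\begin{pmatrix}0&K_1&K_2&K_3\\-K_1&0&0&0\\-K_2&0&0&0\\-K_3&0&0&0\end{pmatrix},\qquad \dot x=h_0,\quad \dot\ell=\bar h,\quad \dot y=\tfrac12\,(x\bar h-h_0\ell).$$ It is arc-length parameterized if $\|h(t)\|=1$ (equivalently $H=1/2$). $\mathbb{G}_4$ is the geometric (Clifford) algebra of Euclidean $\mathbb{R}^4$ with standard orthonormal basis $e_1,e_2,e_3,e_4$, and $\wedge^k\mathbb{R}^4$ is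 its grade-$k$ part. The point $(x,\ell,y)\in N$ is identified with the element $x\,e_1+(\ell_1e_2+\ell_2e_3+\ell_3e_4)+e_1\wedge(y_1e_2+y_2e_3+y_3e_4)$ of $\wedge^1\mathbb{R}^4\oplus\wedge^2\mathbb{R}^4$. The group $SO(3)$ acts on the span of $e_2,e_3,e_4$ and fixes $e_1$, which corresponds to $(x,\ell,y)\mapsto(x,R\ell,Ry)$. *)

theory Defs
  imports "HOL-Analysis.Analysis"
begin

section \<open>The geometric algebra of Euclidean space\<close>

text \<open>A multivector over \<open>\<real>\<^sup>n\<close> is given by its coefficients on the basis blades, which are indexed
  by the subsets \<open>A\<close> of the index type: the blade of \<open>A\<close> is the product of the \<open>e\<^sub>i\<close>, \<open>i \<in> A\<close>, in
  increasing order. The linear order on indices only fixes the sign of each blade; in the numeral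
  type \<open>4\<close> used below, the index \<open>4\<close> equals \<open>0\<close> and is therefore the smallest one.\<close>

type_synonym 'n multivector = "real ^ ('n set)"

text \<open>Sorting the concatenation of two blades takes one transposition for each pair
  \<open>(i, j) \<in> A \<times> B\<close> with \<open>j < i\<close>; then \<open>e\<^sub>i e\<^sub>i = 1\<close> removes the indices in \<open>A \<inter> B\<close>.\<close>

definition blade_sign :: "'n::{finite,linorder} set \<Rightarrow> 'n set \<Rightarrow> real" where
  "blade_sign A B = (\<Prod>i\<in>A. \<Prod>j\<in>B. if j < i then - 1 else 1)"

definition geom_prod ::
  "'n::{finite,linorder} multivector \<Rightarrow> 'n multivector \<Rightarrow> 'n multivector"
  (infixl \<open>\<star>\<close> 70) where
  "a \<star> b = (\<Sum>A\<in>UNIV. \<Sum>B\<in>UNIV. (blade_sign A B * a $ A * b $ B) *\<^sub>R axis (sym_diff A B) 1)"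

definition grade_part :: "nat \<Rightarrow> 'n::finite multivector \<Rightarrow> 'n multivector" where
  "grade_part k a = (\<chi> A. if card A = k then a $ A else 0)"

definition outer_prod ::
  "'n::{finite,linorder} multivector \<Rightarrow> 'n multivector \<Rightarrow> 'n multivector"
  (infixl \<open>\<^bold>\<and>\<close> 72) where
  "a \<^bold>\<and> b = (\<Sum>r\<le>CARD('n). \<Sum>s\<le>CARD('n). grade_part (r + s) (grade_part r a \<star> grade_part s b))"

definition e :: "'n::finite \<Rightarrow> 'n multivector" where
  "e i = axis {i} 1"

subsection \<open>Algebra laws\<close>

lemma prod_sym_diff:
  fixes f :: "'a::finite \<Rightarrow> real"
  assumes "\<And>i. f i * f i = 1"
  shows "(\<Prod>i\<in>sym_diff A B. f i) = (\<Prod>i\<in>A. f i) * (\<Prod>i\<in>B. f i)"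
proof -
  have 1: "prod f (A \<inter> B) * prod f (A \<inter> B) = 1"
    by (simp add: prod.distrib[symmetric] assms)
  have "prod f A = prod f (A - B) * prod f (A \<inter> B)"
    by (metis finite_code mult.commute prod.Int_Diff)
  moreover have "prod f B = prod f (B - A) * prod f (A \<inter> B)"
    by (metis Int_commute finite_code mult.commute prod.Int_Diff)
  moreover have "prod f (sym_diff A B) = prod f (A - B) * prod f (B - A)"
    by (rule prod.union_disjoint) auto
  ultimately show ?thesis
    using 1 by (simp add: algebra_simps)
qed

lemma blade_sign_sym_diff_left:
  "blade_sign (sym_diff A B) C = blade_sign A C * blade_sign B C"
  unfolding blade_sign_def
  by (rule prod_sym_diff) (auto simp: prod.distrib[symmetric] intro!: prod.neutral)

lemma blade_sign_sym_diff_right: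
  "blade_sign A (sym_diff B C) = blade_sign A B * blade_sign A C"
  unfolding blade_sign_def
  by (subst prod_sym_diff) (auto simp: prod.distrib)

lemma sum_axis_nth: "(\<Sum>A\<in>UNIV. (a $ A) *\<^sub>R axis A (1::real)) = a"
  by (simp add: vec_eq_iff axis_def if_distrib[of "(*) _"] cong: if_cong)

lemma bilinear_geom_prod: "bilinear (\<star>)"
  unfolding bilinear_def linear_iff geom_prod_def
  by (simp add: algebra_simps scaleR_left_distrib sum.distrib scaleR_sum_right)

lemma linear_grade_part: "linear (grade_part k)"
  unfolding linear_iff grade_part_def by (simp add: vec_eq_iff)

lemma bilinear_outer_prod: "bilinear (\<^bold>\<and>)"
  unfolding bilinear_def linear_iff outer_prod_def
  by (simp add: linear_add[OF linear_grade_part] linear_cmul[OF linear_grade_part]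
      bilinear_ladd[OF bilinear_geom_prod] bilinear_radd[OF bilinear_geom_prod]
      bilinear_lmul[OF bilinear_geom_prod] bilinear_rmul[OF bilinear_geom_prod]
      sum.distrib scaleR_sum_right)

lemma axis_geom_prod_axis:
  "axis A 1 \<star> axis B 1 = blade_sign A B *\<^sub>R axis (sym_diff A B) 1"
proof -
  have "axis A 1 \<star> axis B 1 = (\<Sum>A'\<in>UNIV. \<Sum>B'\<in>UNIV.
      if B' = B then if A' = A then blade_sign A B *\<^sub>R axis (sym_diff A B) 1 else 0 else 0)"
    unfolding geom_prod_def by (intro sum.cong refl) (auto simp: axis_def)
  then show ?thesis by simp
qed

lemma geom_prod_assoc: "(a \<star> b) \<star> c = a \<star> (b \<star> c)"
proof -
  note bl = bilinear_geom_prod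
  have blade: "(axis A 1 \<star> axis B 1) \<star> axis C 1 = axis A 1 \<star> (axis B 1 \<star> axis C 1)"
    for A B C :: "'a set"
  proof -
    have "sym_diff (sym_diff A B) C = sym_diff A (sym_diff B C)" by auto
    then show ?thesis
      by (simp add: axis_geom_prod_axis bilinear_lmul[OF bl] bilinear_rmul[OF bl]
          blade_sign_sym_diff_left blade_sign_sym_diff_right mult_ac del: Un_iff)
  qed
  have lin: "linear (\<lambda>a. a \<star> b)" "linear (\<lambda>b. a \<star> b)" for a b :: "'a multivector"
    using bl by (auto simp: bilinear_def)
  have ext: "f a = g a" if "linear f" "linear g" "\<And>A. f (axis A 1) = g (axis A 1)"
    for f g :: "'a multivector \<Rightarrow> 'a multivector" and a
  proof -
    have "f (\<Sum>A\<in>UNIV. (a $ A) *\<^sub>R axis A 1) = g (\<Sum>A\<in>UNIV. (a $ A) *\<^sub>R axis A 1)"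
      by (simp add: linear_sum[OF that(1)] linear_sum[OF that(2)] linear_cmul[OF that(1)]
          linear_cmul[OF that(2)] that(3))
    then show ?thesis by (simp add: sum_axis_nth)
  qed
  note comp = linear_compose[unfolded o_def]
  have 1: "(axis A 1 \<star> axis B 1) \<star> c = axis A 1 \<star> (axis B 1 \<star> c)" for A B :: "'a set" and c
    by (rule ext[where f="\<lambda>c. (axis A 1 \<star> axis B 1) \<star> c"
        and g="\<lambda>c. axis A 1 \<star> (axis B 1 \<star> c)"])
      (auto intro: lin comp[OF lin(2) lin(2)] blade)
  have 2: "(axis A 1 \<star> b) \<star> c = axis A 1 \<star> (b \<star> c)" for A :: "'a set" and b c
    by (rule ext[where f="\<lambda>b. (axis A 1 \<star> b) \<star> c" and g="\<lambda>b. axis A 1 \<star> (b \<star> c)"])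
      (auto intro: comp[OF lin(2) lin(1)] comp[OF lin(1) lin(2)] 1)
  show ?thesis
    by (rule ext[where f="\<lambda>a. (a \<star> b) \<star> c" and g="\<lambda>a. a \<star> (b \<star> c)"])
      (auto intro: comp[OF lin(1) lin(1)] lin 2)
qed

lemma geom_prod_unit: "axis {} 1 \<star> a = a" "a \<star> axis {} 1 = a"
proof -
  note bl = bilinear_geom_prod
  have lin: "linear (\<lambda>a. a \<star> b)" "linear (\<lambda>b. a \<star> b)" for a b :: "'a multivector"
    using bl by (auto simp: bilinear_def)
  have "axis {} 1 \<star> (\<Sum>A\<in>UNIV. (a $ A) *\<^sub>R axis A 1) = (\<Sum>A\<in>UNIV. (a $ A) *\<^sub>R axis A 1)"
    by (simp add: linear_sum[OF lin(2)] linear_cmul[OF lin(2)] axis_geom_prod_axis blade_sign_def)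
  then show "axis {} 1 \<star> a = a" by (simp add: sum_axis_nth)
  have "(\<Sum>A\<in>UNIV. (a $ A) *\<^sub>R axis A 1) \<star> axis {} 1 = (\<Sum>A\<in>UNIV. (a $ A) *\<^sub>R axis A 1)"
    by (simp add: linear_sum[OF lin(1)] linear_cmul[OF lin(1)] axis_geom_prod_axis blade_sign_def)
  then show "a \<star> axis {} 1 = a" by (simp add: sum_axis_nth)
qed

lemma e_geom_prod_e:
  "e i \<star> e i = axis {} 1"
  "i \<noteq> j \<Longrightarrow> e i \<star> e j = - (e j \<star> e i)"
proof -
  show "e i \<star> e i = axis {} 1"
    by (simp add: e_def axis_geom_prod_axis blade_sign_def)
  assume "i \<noteq> j"
  then have "sym_diff {i} {j} = {i, j}" "sym_diff {j} {i} = {i, j}" by auto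
  then show "e i \<star> e j = - (e j \<star> e i)"
    using \<open>i \<noteq> j\<close> by (auto simp: e_def axis_geom_prod_axis blade_sign_def)
qed

lemma grade_part_axis: "grade_part k (axis A 1) = (if card A = k then axis A 1 else 0)"
  by (auto simp: grade_part_def vec_eq_iff axis_def)

lemma e_outer_prod_e:
  "e i \<^bold>\<and> e i = 0"
  "i \<noteq> j \<Longrightarrow> e i \<^bold>\<and> e j = e i \<star> e j"
proof -
  note bl = bilinear_geom_prod
  have "e i \<^bold>\<and> e j = grade_part 2 (e i \<star> e j)" for i j :: 'a
  proof -
    have "e i \<^bold>\<and> e j = (\<Sum>r\<le>CARD('a). \<Sum>s\<le>CARD('a).
        if s = 1 then if r = 1 then grade_part 2 (e i \<star> e j) else 0 else 0)"
      unfolding outer_prod_def e_def grade_part_axis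
      by (intro sum.cong refl) (auto simp: bilinear_lzero[OF bl] bilinear_rzero[OF bl]
          linear_0[OF linear_grade_part] numeral_2_eq_2)
    moreover have "CARD('a) \<ge> 1" by (simp add: Suc_leI)
    ultimately show ?thesis by simp
  qed
  note * = this
  show "e i \<^bold>\<and> e i = 0"
    unfolding *
    by (simp add: e_def axis_geom_prod_axis linear_cmul[OF linear_grade_part] grade_part_axis)
  assume "i \<noteq> j"
  moreover from this have "sym_diff {i} {j} = {i, j}" by auto
  ultimately show "e i \<^bold>\<and> e j = e i \<star> e j"
    unfolding *
    by (simp add: e_def axis_geom_prod_axis linear_cmul[OF linear_grade_part] grade_part_axis)
qed


section \<open>The (4,7) control problem\<close>

text \<open>The component \<open>h $ 1\<close> is \<open>h\<^sub>0\<close>, and \<open>h $ 2\<close>, \<open>h $ 3\<close>, \<open>h $ 4\<close> are \<open>h\<^sub>1\<close>, \<open>h\<^sub>2\<close>, \<open>h\<^sub>3\<close>.\<close>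

definition hor0 :: "real ^ 4 \<Rightarrow> real" where
  "hor0 h = h $ 1"

definition hor_bar :: "real ^ 4 \<Rightarrow> real ^ 3" where
  "hor_bar h = vector [h $ 2, h $ 3, h $ 4]"

definition Omega :: "real ^ 3 \<Rightarrow> real ^ 4 ^ 4" where
  "Omega k = vector
    [vector [0, k $ 1, k $ 2, k $ 3],
     vector [- k $ 1, 0, 0, 0],
     vector [- k $ 2, 0, 0, 0],
     vector [- k $ 3, 0, 0, 0]]"

lemma vector_4:
  "(vector [a, b, c, d] :: 'a::zero ^ 4) $ 1 = a"
  "(vector [a, b, c, d] :: 'a ^ 4) $ 2 = b"
  "(vector [a, b, c, d] :: 'a ^ 4) $ 3 = c"
  "(vector [a, b, c, d] :: 'a ^ 4) $ 4 = d"
  unfolding vector_def by auto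

text \<open>\<open>geodesic_on I k h x l y\<close>: the curve \<open>(x, l, y)\<close>, defined on the nondegenerate interval \<open>I\<close>,
  is the projection of a normal extremal with vertical constants \<open>k\<close> and horizontal
  covector components \<open>h\<close>. At an endpoint of \<open>I\<close> the derivatives are one-sided.\<close>

definition geodesic_on ::
  "real set \<Rightarrow> real ^ 3 \<Rightarrow> (real \<Rightarrow> real ^ 4) \<Rightarrow>
   (real \<Rightarrow> real) \<Rightarrow> (real \<Rightarrow> real ^ 3) \<Rightarrow> (real \<Rightarrow> real ^ 3) \<Rightarrow> bool" where
  "geodesic_on I k h x l y \<longleftrightarrow>
     is_interval I \<and> interior I \<noteq> {} \<and>
     (\<forall>t\<in>I.
       (h has_vector_derivative - (Omega k *v h t)) (at t within I) \<and>
       (x has_real_derivative hor0 (h t)) (at t within I) \<and>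
       (l has_vector_derivative hor_bar (h t)) (at t within I) \<and>
       (y has_vector_derivative
          (1/2) *\<^sub>R (x t *\<^sub>R hor_bar (h t) - hor0 (h t) *\<^sub>R l t)) (at t within I))"

definition arc_length_param :: "real set \<Rightarrow> (real \<Rightarrow> real ^ 4) \<Rightarrow> bool" where
  "arc_length_param I h \<longleftrightarrow> (\<forall>t\<in>I. norm (h t) = 1)"

definition point_G4 :: "real \<Rightarrow> real ^ 3 \<Rightarrow> real ^ 3 \<Rightarrow> 4 multivector" where
  "point_G4 x l y =
     x *\<^sub>R e 1 + (l $ 1 *\<^sub>R e 2 + l $ 2 *\<^sub>R e 3 + l $ 3 *\<^sub>R e 4)
     + e 1 \<^bold>\<and> (y $ 1 *\<^sub>R e 2 + y $ 2 *\<^sub>R e 3 + y $ 3 *\<^sub>R e 4)"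

end

theory Submission
  imports Defs
begin

text \<open>Take a positively oriented orthonormal frame of \<open>\<real>\<^sup>3\<close> whose first vector points along \<open>k\<close> and
  whose third vector is orthogonal to both \<open>k\<close> and the initial covector, and let \<open>R\<close> pass to its
  coordinates. The pair formed by \<open>h\<^sub>0\<close> and the first coordinate then rotates with angular speed
  \<open>K = \<parallel>k\<parallel>\<close>, the second coordinate is constant and the third one vanishes. The curve follows by
  integrating twice; at each stage the closed form is identified by its derivative and its value
  at \<open>0\<close>.\<close>

text \<open>The difference has zero derivative, hence is constant on a convex set. Derivatives are
  taken within \<open>I\<close>, so one-sided derivatives at endpoints are covered. Every closed
  form below is identified through this lemma.\<close>

lemma has_real_derivative_unique_on_convex:
  fixes f g :: "real \<Rightarrow> real"
  assumes "convex I" "a \<in> I" "t \<in> I" "f a = g a"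
    and f: "\<And>s. s \<in> I \<Longrightarrow> (f has_real_derivative f' s) (at s within I)"
    and g: "\<And>s. s \<in> I \<Longrightarrow> (g has_real_derivative f' s) (at s within I)"
  shows "f t = g t"
proof -
  have "((\<lambda>s. f s - g s) has_vector_derivative 0) (at s within I)" if "s \<in> I" for s
    using DERIV_diff[OF f[OF that] g[OF that]]
    by (simp add: has_real_derivative_iff_has_vector_derivative)
  from has_vector_derivative_zero_constant[OF \<open>convex I\<close> this]
  obtain c where "\<And>s. s \<in> I \<Longrightarrow> f s - g s = c" by blast
  from this[OF \<open>a \<in> I\<close>] this[OF \<open>t \<in> I\<close>] \<open>f a = g a\<close> show ?thesis by simp
qed

lemma has_real_derivative_vec_nth:
  fixes f :: "real \<Rightarrow> real ^ 'n"
  assumes "(f has_vector_derivative f') F"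
  shows "((\<lambda>t. f t $ i) has_real_derivative f' $ i) F"
  using bounded_linear.has_vector_derivative[OF bounded_linear_vec_nth assms]
  by (simp add: has_real_derivative_iff_has_vector_derivative)

text \<open>Turning \<open>(p, q)\<close> back by the angle \<open>K * t\<close> gives a pair with
  zero derivative, which therefore keeps its initial value \<open>(p 0, q 0)\<close>.\<close>

lemma harmonic_oscillator_solution:
  fixes p q :: "real \<Rightarrow> real"
  assumes "convex I" "0 \<in> I" "t \<in> I"
    and p: "\<And>s. s \<in> I \<Longrightarrow> (p has_real_derivative - K * q s) (at s within I)"
    and q: "\<And>s. s \<in> I \<Longrightarrow> (q has_real_derivative K * p s) (at s within I)"
  shows "p t = p 0 * cos (K * t) - q 0 * sin (K * t)"
    and "q t = p 0 * sin (K * t) + q 0 * cos (K * t)"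
proof -
  have 1: "p t * cos (K * t) + q t * sin (K * t) = p 0"
    by (rule has_real_derivative_unique_on_convex[where I=I and a=0 and f'="\<lambda>_. 0"
        and f="\<lambda>t. p t * cos (K * t) + q t * sin (K * t)" and g="\<lambda>_. p 0"])
      (auto intro!: assms derivative_eq_intros)
  have 2: "q t * cos (K * t) - p t * sin (K * t) = q 0"
    by (rule has_real_derivative_unique_on_convex[where I=I and a=0 and f'="\<lambda>_. 0"
        and f="\<lambda>t. q t * cos (K * t) - p t * sin (K * t)" and g="\<lambda>_. q 0"])
      (auto intro!: assms derivative_eq_intros)
  have 3: "cos (K * t) * cos (K * t) + sin (K * t) * sin (K * t) = 1"
    using sin_cos_squared_add[of "K * t"] by (simp add: power2_eq_square)
  show "p t = p 0 * cos (K * t) - q 0 * sin (K * t)"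
    \<comment> \<open>Replacing \<open>p 0\<close> and \<open>q 0\<close> by the conserved
      expressions amounts to turning forward again, so only \<open>cos^2 + sin^2 = 1\<close> is left
      to use.\<close>
    unfolding 1[symmetric] 2[symmetric] using 3 by algebra
  show "q t = p 0 * sin (K * t) + q 0 * cos (K * t)"
    unfolding 1[symmetric] 2[symmetric] using 3 by algebra
qed

text \<open>One Gram-Schmidt step: \<open>v\<close> is the normalized component of \<open>w\<close>
  orthogonal to \<open>u\<close>. If \<open>w\<close> is a multiple of \<open>u\<close>, this
  component is zero and any unit vector orthogonal to \<open>u\<close> serves.\<close>

lemma unit_vector_orthogonal_spanning:
  fixes u w :: "real ^ 3"
  assumes "norm u = 1"
  obtains v where "norm v = 1" "u \<bullet> v = 0" "w = (u \<bullet> w) *\<^sub>R u + (v \<bullet> w) *\<^sub>R v"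
proof -
  define z where "z = w - (u \<bullet> w) *\<^sub>R u"
  have uu: "u \<bullet> u = 1"
    using assms by (simp add: dot_square_norm)
  have uz: "u \<bullet> z = 0"
    by (simp add: z_def inner_diff_right uu)
  show thesis
  proof (cases "z = 0")
    case True
    obtain v0 where v0: "v0 \<noteq> 0" "orthogonal u v0"
      using orthogonal_to_vector_exists[of u] by auto
    define v where "v = sgn v0"
    have v: "norm v = 1" "u \<bullet> v = 0"
      using v0 by (auto simp: v_def norm_sgn sgn_div_norm orthogonal_def)
    have "w = (u \<bullet> w) *\<^sub>R u"
      using True by (simp add: z_def)
    moreover from this have "v \<bullet> w = 0"
      using v(2) by (metis inner_commute inner_scaleR_right mult_zero_right)
    ultimately show thesis
      using that[OF v] by simp
  next
    case False
    define v where "v = sgn z"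
    have v: "norm v = 1" "u \<bullet> v = 0"
      using False uz by (auto simp: v_def norm_sgn sgn_div_norm)
    have w: "w = (u \<bullet> w) *\<^sub>R u + norm z *\<^sub>R v"
      using False by (simp add: v_def sgn_div_norm z_def)
    have "v \<bullet> w = v \<bullet> ((u \<bullet> w) *\<^sub>R u + norm z *\<^sub>R v)"
      using w by simp
    also have "\<dots> = norm z"
      using v by (simp add: inner_add_right inner_commute[of v u] dot_square_norm)
    finally show thesis
      using that[OF v] w by simp
  qed
qed

text \<open>The rows of \<open>R\<close> are \<open>u\<close> along \<open>k\<close>, a unit
  \<open>v\<close> orthogonal to \<open>u\<close> with \<open>w\<close> in the span of both, and
  their cross product. The cross product as third row makes the determinant 1 rather than -1, and it
  is orthogonal to \<open>w\<close>.\<close>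

lemma rotation_matrix_aligning_two_vectors:
  fixes k w :: "real ^ 3"
  obtains R :: "real ^ 3 ^ 3" where
    "rotation_matrix R" "R *v k = norm k *\<^sub>R axis 1 1" "(R *v w) $ 3 = 0"
proof -
  obtain u :: "real ^ 3" where u: "norm u = 1" "k = norm k *\<^sub>R u"
  proof (cases "k = 0")
    case True
    then show thesis using that[of "axis 1 1"] by simp
  next
    case False
    then show thesis using that[of "sgn k"] by (simp add: norm_sgn sgn_div_norm)
  qed
  obtain v where v: "norm v = 1" "u \<bullet> v = 0" "w = (u \<bullet> w) *\<^sub>R u + (v \<bullet> w) *\<^sub>R v"
    using unit_vector_orthogonal_spanning[OF u(1)] .
  define n where "n = cross3 u v"
  define R :: "real ^ 3 ^ 3" where "R = vector [u, v, n]"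
  have R: "R $ 1 = u" "R $ 2 = v" "R $ 3 = n"
    by (simp_all add: R_def)
  have un: "u \<bullet> n = 0" "v \<bullet> n = 0"
    by (simp_all add: n_def dot_cross_self)
  have nn: "norm n = 1"
    using norm_cross_dot[of u v] u(1) v(1,2) by (simp add: n_def abs_square_eq_1)
  have Rv: "(R *v z) $ 1 = u \<bullet> z" "(R *v z) $ 2 = v \<bullet> z" "(R *v z) $ 3 = n \<bullet> z" for z
    by (simp_all add: matrix_vector_mul_component R)
  have "orthogonal_matrix R"
    unfolding orthogonal_matrix_orthonormal_rows
    using u(1) v(1,2) un nn
    by (auto simp: row_def R forall_3 orthogonal_def inner_commute)
  moreover have "det R = 1"
  proof -
    have "det R = u \<bullet> cross3 v n"
      by (simp add: R_def dot_cross_det)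
    \<comment> \<open>The triple product is cyclic:
      \<open>u . (v x n) = n . (u x v)\<close>.\<close>
    also have "\<dots> = n \<bullet> n"
      by (metis cross_triple inner_commute n_def)
    finally show ?thesis
      using nn by (simp add: dot_square_norm)
  qed
  moreover have "R *v k = norm k *\<^sub>R axis 1 1"
  proof -
    have "(R *v u) = axis 1 1"
      using u(1) v(2) un
      by (simp add: vec_eq_iff forall_3 Rv axis_def inner_commute dot_square_norm)
    then show ?thesis
      by (metis u(2) matrix_vector_mult_scaleR)
  qed
  moreover have "(R *v w) $ 3 = 0"
    unfolding Rv by (subst v(3)) (simp add: inner_add_right un inner_commute[of n])
  ultimately show thesis
    using that by (simp add: rotation_matrix_def)
qed

lemma hor_bar_nth: "hor_bar z $ 1 = z $ 2" "hor_bar z $ 2 = z $ 3" "hor_bar z $ 3 = z $ 4"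
  by (simp_all add: hor_bar_def)

lemma bounded_linear_hor_bar: "bounded_linear hor_bar"
  unfolding linear_conv_bounded_linear[symmetric] linear_iff
  by (simp add: vec_eq_iff forall_3 hor_bar_nth)

text \<open>Together with \<open>hor_bar_Omega\<close> this splits the covector equation into the
  scalar equation \<open>h0' = - k . hbar\<close> and the vector equation
  \<open>hbar' = h0 k\<close>.\<close>

lemma hor0_Omega: "hor0 (Omega k *v z) = k \<bullet> hor_bar z"
  by (simp add: hor0_def Omega_def matrix_vector_mult_def sum_4 vector_4 inner_vec_def sum_3
      hor_bar_nth)

lemma hor_bar_Omega: "hor_bar (Omega k *v z) = - (hor0 z *\<^sub>R k)"
  by (simp add: vec_eq_iff forall_3 hor_bar_nth hor0_def Omega_def matrix_vector_mult_def sum_4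
      vector_4)

lemma norm_hor_decomp: "(hor0 z)\<^sup>2 + (norm (hor_bar z))\<^sup>2 = (norm z)\<^sup>2"
  unfolding power2_norm_eq_inner
  by (simp add: inner_vec_def sum_3 sum_4 hor_bar_nth hor0_def power2_eq_square)

theorem proposition4:
  fixes I :: "real set" and k :: "real ^ 3" and h :: "real \<Rightarrow> real ^ 4"
    and x :: "real \<Rightarrow> real" and l y :: "real \<Rightarrow> real ^ 3"
  assumes "geodesic_on I k h x l y"
    and "arc_length_param I h"
    and "0 \<in> I" and "x 0 = 0" and "l 0 = 0" and "y 0 = 0"
    and "k \<noteq> 0"
  shows "\<exists>(R :: real ^ 3 ^ 3) (K :: real) (C1 :: real) (C2 :: real) (C :: real).
    rotation_matrix R \<and> K > 0 \<and> K\<^sup>2 * (C1\<^sup>2 + C2\<^sup>2) + C\<^sup>2 = 1 \<and>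
    (\<forall>t\<in>I. point_G4 (x t) (R *v l t) (R *v y t) =
        (C1 * cos (K * t) + C2 * sin (K * t) - C1) *\<^sub>R e 1
      + (C1 * sin (K * t) - C2 * cos (K * t) + C2) *\<^sub>R e 2
      + (C * t) *\<^sub>R e 3
      + ((1/2) * (C1\<^sup>2 + C2\<^sup>2) * (K * t - sin (K * t))) *\<^sub>R (e 1 \<^bold>\<and> e 2)
      + ((C / (2 * K)) * ((2 * C1 - C2 * K * t) * sin (K * t)
            - (C1 * K * t + 2 * C2) * cos (K * t) + 2 * C2 - C1 * K * t)) *\<^sub>R (e 1 \<^bold>\<and> e 3))"
proof -
  define K where "K = norm k"
  have K: "K > 0" using \<open>k \<noteq> 0\<close> by (simp add: K_def)
  obtain R :: "real ^ 3 ^ 3" where R: "rotation_matrix R" "R *v k = K *\<^sub>R axis 1 1"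
    and R3: "(R *v hor_bar (h 0)) $ 3 = 0"
    unfolding K_def using rotation_matrix_aligning_two_vectors .
  have orth: "orthogonal_transformation ((*v) R)"
    using R(1) by (simp add: rotation_matrix_def orthogonal_transformation_matrix)
  have blR: "bounded_linear ((*v) R)" by (simp add: linear_linear)
  have conv: "convex I"
    using assms(1) by (simp add: geodesic_on_def is_interval_convex)
  have dh: "(h has_vector_derivative - (Omega k *v h t)) (at t within I)"
    and dx: "(x has_real_derivative hor0 (h t)) (at t within I)"
    and dl: "(l has_vector_derivative hor_bar (h t)) (at t within I)"
    and dy: "(y has_vector_derivative
          (1/2) *\<^sub>R (x t *\<^sub>R hor_bar (h t) - hor0 (h t) *\<^sub>R l t)) (at t within I)"
    if "t \<in> I" for t
    using assms(1) that by (auto simp: geodesic_on_def)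
  define p where "p t = hor0 (h t)" for t
  define g where "g t = R *v hor_bar (h t)" for t
  define L where "L t = R *v l t" for t
  define Y where "Y t = R *v y t" for t
  have dp: "(p has_real_derivative - K * g t $ 1) (at t within I)" if "t \<in> I" for t
  proof -
    \<comment> \<open>\<open>R\<close> preserves inner products, and \<open>R *v k\<close> lies on
      the first axis, so only the first coordinate of \<open>g\<close> enters.\<close>
    have "k \<bullet> hor_bar (h t) = (R *v k) \<bullet> g t"
      using orth by (simp add: orthogonal_transformation_def g_def)
    also have "\<dots> = K * g t $ 1"
      by (simp add: R inner_axis inner_commute)
    finally show ?thesis
      using has_real_derivative_vec_nth[OF dh[OF that], of 1] hor0_Omega[of k "h t"]
      by (simp add: p_def[abs_def] hor0_def)
  qed
  have dg: "(g has_vector_derivative p t *\<^sub>R K *\<^sub>R axis 1 1) (at t within I)" if "t \<in> I" for t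
  proof -
    note bl = bounded_linear.has_vector_derivative[OF blR
        bounded_linear.has_vector_derivative[OF bounded_linear_hor_bar dh[OF that]]]
    have "hor_bar (- (Omega k *v h t)) = p t *\<^sub>R k"
      by (simp add: linear_neg[OF bounded_linear.linear[OF bounded_linear_hor_bar]]
          hor_bar_Omega p_def)
    then show ?thesis
      using bl by (simp add: g_def[abs_def] matrix_vector_mult_scaleR R)
  qed
  have dL: "(L has_vector_derivative g t) (at t within I)" if "t \<in> I" for t
    using bounded_linear.has_vector_derivative[OF blR dl[OF that]]
    by (simp add: L_def[abs_def] g_def)
  have dY: "(Y has_vector_derivative (1/2) *\<^sub>R (x t *\<^sub>R g t - p t *\<^sub>R L t)) (at t within I)"
    if "t \<in> I" for t
    using bounded_linear.has_vector_derivative[OF blR dy[OF that]]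
    by (simp add: Y_def[abs_def] L_def g_def p_def matrix_vector_mult_scaleR
        matrix_vector_mult_diff_distrib)
  note dgi = dg[THEN has_real_derivative_vec_nth] and dLi = dL[THEN has_real_derivative_vec_nth]
    and dYi = dY[THEN has_real_derivative_vec_nth]
  note unique = has_real_derivative_unique_on_convex[OF conv \<open>0 \<in> I\<close>]
  have L0: "L 0 = 0" and Y0: "Y 0 = 0"
    by (simp_all add: L_def Y_def assms)

  \<comment> \<open>Dividing the initial velocities by \<open>K\<close> absorbs the factor
    \<open>1 / K\<close> that arises when sine and cosine are integrated to obtain \<open>x\<close>
    and \<open>L\<close>.\<close>
  define C1 where "C1 = g 0 $ 1 / K"
  define C2 where "C2 = p 0 / K"
  define C where "C = g 0 $ 2"
  have g0: "g 0 $ 1 = K * C1" "p 0 = K * C2"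
    using K by (simp_all add: C1_def C2_def)
  have pt: "p t = K * (C2 * cos (K * t) - C1 * sin (K * t))"
    and g1: "g t $ 1 = K * (C2 * sin (K * t) + C1 * cos (K * t))" if "t \<in> I" for t
    using harmonic_oscillator_solution[OF conv \<open>0 \<in> I\<close> that, of p K "\<lambda>t. g t $ 1"] dp
      dgi[where i=1]
    by (simp_all add: g0 algebra_simps)
  have g2: "g t $ 2 = C" if "t \<in> I" for t
    by (rule unique[where f'="\<lambda>_. 0"])
      (use that dgi[where i=2] in \<open>auto simp: C_def axis_def\<close>)
  \<comment> \<open>The third coordinate is constant because \<open>g'\<close> points along the
    first axis, and the choice of \<open>R\<close> makes it vanish at 0.\<close>
  have g3: "g t $ 3 = 0" if "t \<in> I" for t
    by (rule unique[where f'="\<lambda>_. 0"])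
      (use that dgi[where i=3] R3 in \<open>auto simp: g_def axis_def\<close>)
  \<comment> \<open>This is the unit-speed condition at time 0, written in rotated
    coordinates.\<close>
  have norm1: "K\<^sup>2 * (C1\<^sup>2 + C2\<^sup>2) + C\<^sup>2 = 1"
  proof -
    have "(p 0)\<^sup>2 + (norm (g 0))\<^sup>2 = (norm (h 0))\<^sup>2"
      using orth by (simp add: g_def p_def orthogonal_transformation_norm norm_hor_decomp)
    also have "\<dots> = 1"
      using assms(2,3) by (simp add: arc_length_param_def)
    also have "(norm (g 0))\<^sup>2 = (g 0 $ 1)\<^sup>2 + (g 0 $ 2)\<^sup>2"
      unfolding power2_norm_eq_inner
      by (simp add: inner_vec_def sum_3 g3[OF \<open>0 \<in> I\<close>] power2_eq_square)
    finally show ?thesis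
      by (simp add: g0 C_def algebra_simps power_mult_distrib)
  qed
  have xt: "x t = C1 * cos (K * t) + C2 * sin (K * t) - C1" if "t \<in> I" for t
    by (rule unique[OF that _ dx])
      (auto intro!: derivative_eq_intros simp: assms p_def[symmetric] pt algebra_simps)
  have L1: "L t $ 1 = C1 * sin (K * t) - C2 * cos (K * t) + C2" if "t \<in> I" for t
    by (rule unique[OF that _ dLi])
      (auto intro!: derivative_eq_intros simp: L0 g1 algebra_simps)
  have L2: "L t $ 2 = C * t" if "t \<in> I" for t
    by (rule unique[OF that _ dLi])
      (auto intro!: derivative_eq_intros simp: L0 g2)
  have L3: "L t $ 3 = 0" if "t \<in> I" for t
    by (rule unique[OF that _ dLi])
      (auto intro!: derivative_eq_intros simp: L0 g3)
  have Y1: "Y t $ 1 = (1/2) * (C1\<^sup>2 + C2\<^sup>2) * (K * t - sin (K * t))" if "t \<in> I" for t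
  proof (rule unique[OF that _ dYi])
    fix s assume s: "s \<in> I"
    have "cos (K * s) * cos (K * s) + sin (K * s) * sin (K * s) = 1"
      using sin_cos_squared_add[of "K * s"] by (simp add: power2_eq_square)
    \<comment> \<open>The quadratic terms combine by \<open>cos^2 + sin^2 = 1\<close>, and the mixed
      terms \<open>C1 * C2 * sin (K * s)\<close> cancel.\<close>
    then have "x s * g s $ 1 - p s * L s $ 1 = (C1\<^sup>2 + C2\<^sup>2) * (K - K * cos (K * s))"
      unfolding xt[OF s] g1[OF s] pt[OF s] L1[OF s] by algebra
    then show "((\<lambda>t. (1/2) * (C1\<^sup>2 + C2\<^sup>2) * (K * t - sin (K * t))) has_real_derivative
        ((1/2) *\<^sub>R (x s *\<^sub>R g s - p s *\<^sub>R L s)) $ 1) (at s within I)"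
      by (auto intro!: derivative_eq_intros)
  qed (simp add: Y0)
  have Y2: "Y t $ 2 = (C / (2 * K)) * ((2 * C1 - C2 * K * t) * sin (K * t)
            - (C1 * K * t + 2 * C2) * cos (K * t) + 2 * C2 - C1 * K * t)" if "t \<in> I" for t
  proof (rule unique[OF that _ dYi])
    fix s assume s: "s \<in> I"
    \<comment> \<open>The required derivative is \<open>C / 2 * (x s - s * p s)\<close> with
      \<open>p = x'\<close>; the products of \<open>t\<close> with sine and cosine in the primitive
      come from integrating \<open>s * p s\<close> by parts.\<close>
    show "((\<lambda>t. (C / (2 * K)) * ((2 * C1 - C2 * K * t) * sin (K * t)
            - (C1 * K * t + 2 * C2) * cos (K * t) + 2 * C2 - C1 * K * t)) has_real_derivative
        ((1/2) *\<^sub>R (x s *\<^sub>R g s - p s *\<^sub>R L s)) $ 2) (at s within I)"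
      using K by (auto intro!: derivative_eq_intros simp: xt[OF s] g2[OF s] pt[OF s] L2[OF s])
        (simp add: field_simps)
  qed (simp add: Y0)
  have Y3: "Y t $ 3 = 0" if "t \<in> I" for t
    by (rule unique[OF that _ dYi])
      (auto intro!: derivative_eq_intros simp: Y0 g3 L3)
  have "\<forall>t\<in>I. point_G4 (x t) (R *v l t) (R *v y t) =
        (C1 * cos (K * t) + C2 * sin (K * t) - C1) *\<^sub>R e 1
      + (C1 * sin (K * t) - C2 * cos (K * t) + C2) *\<^sub>R e 2
      + (C * t) *\<^sub>R e 3
      + ((1/2) * (C1\<^sup>2 + C2\<^sup>2) * (K * t - sin (K * t))) *\<^sub>R (e 1 \<^bold>\<and> e 2)
      + ((C / (2 * K)) * ((2 * C1 - C2 * K * t) * sin (K * t)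
            - (C1 * K * t + 2 * C2) * cos (K * t) + 2 * C2 - C1 * K * t)) *\<^sub>R (e 1 \<^bold>\<and> e 3)"
    unfolding L_def[symmetric] Y_def[symmetric] point_G4_def
    \<comment> \<open>Bilinearity distributes \<open>e 1\<close> over the coordinates of
      \<open>Y\<close>; the \<open>e 4\<close> and \<open>e 1\<close>-\<open>e 4\<close> terms drop
      out because \<open>L3\<close> and \<open>Y3\<close> make their coefficients zero.\<close>
    by (intro ballI, simp only: xt L1 L2 L3 Y1 Y2 Y3 bilinear_radd[OF bilinear_outer_prod]
        bilinear_rmul[OF bilinear_outer_prod]) simp
  with R(1) K norm1 show ?thesis by blast
qed

end
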